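(* Let $\mathcal C\subseteq\mathbb N$ be a (possibly infinite) ruleset with $\{1,2,3\}\subseteq\mathcal C$. Then, in the partition game with ruleset $\mathcal C$, $\mathcal G(n)=n-1$ for every heap size $n\ge1$.
   Context: $\mathbb N=\{1,2,\ldots\}$ and $\mathbb N_0=\mathbb N\cup\{0\}$. A ruleset is a set $\mathcal C\subseteq\mathbb N$ of allowed cut-numbers. In the partition game with ruleset $\mathcal C$, positions are finite collections (disjunctive sums) of heaps of positive integer sizes; a move chooses one heap, of size $n$, chooses $c\in\mathcal C$, and replaces that heap by $c+1$ heaps of positive integer sizes $n_0,\ldots,n_c$ with $n_0+\cdots+n_c=n$ (a $c$-cut). The Sprague-Grundy value of a single heap of size $n\ge1$ is defined recursively by $$\mathcal G(n)=\operatorname{mex}\{\mathcal G(n_0)\oplus\cdots\oplus\mathcal G(n_c)\mid c\in\mathcal C,\ n_i\in\mathbb N,\ n_0+\cdots+n_c=n\},$$ where $\oplus$ is nim-sum (bitwise XOR) and $\operatorname{mex}(U)=\min(\mathbb N_0\setminus U)$. *)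

theory Defs
  imports Main
begin

text \<open>The least excluded value; it exists whenever \<open>U\<close> is finite.\<close>

definition mex :: "nat set \<Rightarrow> nat" where
  "mex U = (LEAST k. k \<notin> U)"

definition nim_sum :: "nat list \<Rightarrow> nat" where
  "nim_sum xs = foldr xor xs 0"

definition ruleset :: "nat set \<Rightarrow> bool" where
  "ruleset C \<longleftrightarrow> C \<subseteq> {1..}"

text \<open>
  All results of cutting a heap of size \<open>n\<close>: lists \<open>[n\<^sub>0, \<dots>, n\<^sub>c]\<close> of positive heap sizes
  with sum \<open>n\<close>, where \<open>c\<close> is an allowed cut-number. The condition \<open>c \<ge> 1\<close> is redundant for
  rulesets; it makes the recursion for \<open>grundy\<close> terminate for arbitrary sets \<open>C\<close>.
\<close>

definition cuts :: "nat set \<Rightarrow> nat \<Rightarrow> nat list set" where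
  "cuts C n = {ns. \<exists>c\<in>C. c \<ge> 1 \<and> length ns = c + 1 \<and> (\<forall>m\<in>set ns. m \<ge> 1) \<and> sum_list ns = n}"

lemma cuts_less:
  assumes "ns \<in> cuts C n" and "m \<in> set ns"
  shows "m < n"
proof -
  obtain xs ys where ns: "ns = xs @ m # ys"
    using assms(2) by (meson split_list)
  have pos: "\<forall>k\<in>set ns. k \<ge> 1" and len: "length ns \<ge> 2" and sum: "sum_list ns = n"
    using assms(1) by (auto simp: cuts_def)
  have "xs @ ys \<noteq> []"
    using len ns by auto
  then obtain k where k: "k \<in> set (xs @ ys)"
    by (meson hd_in_set)
  then have "k \<ge> 1" and "k \<le> sum_list (xs @ ys)"
    using pos ns by (auto intro: member_le_sum_list trans_le_add1 trans_le_add2)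
  then show ?thesis
    using sum ns by simp
qed

lemma finite_cuts: "finite (cuts C n)"
proof (rule finite_subset)
  have "length ns \<le> sum_list ns" if "\<forall>m\<in>set ns. m \<ge> 1" for ns :: "nat list"
    using that by (induction ns) auto
  then show "cuts C n \<subseteq> {ns. set ns \<subseteq> {..n} \<and> length ns \<le> n}"
    by (fastforce simp: cuts_def intro: member_le_sum_list)
  show "finite {ns. set ns \<subseteq> {..n} \<and> length ns \<le> n}"
    by (rule finite_lists_length_le) simp
qed

text \<open>The Sprague--Grundy value of a single heap of size \<open>n\<close> in the partition game.\<close>

function grundy :: "nat set \<Rightarrow> nat \<Rightarrow> nat" where
  "grundy C n = mex ((\<lambda>ns. nim_sum (map (grundy C) ns)) ` cuts C n)"
  by auto
termination
  by (relation "measure snd") (auto dest: cuts_less)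

declare grundy.simps [simp del]

end

theory Submission imports Defs
begin

text \<open>
  Write \<open>n\<^sub>i = m\<^sub>i + 1\<close>, so that by induction a cut of \<open>n\<close> into \<open>c + 1\<close> heaps has nim-value
  \<open>m\<^sub>0 \<oplus> \<dots> \<oplus> m\<^sub>c\<close> with \<open>m\<^sub>0 + \<dots> + m\<^sub>c = n - 1 - c\<close>. Addition without carries never exceeds
  ordinary addition, so this nim-value is at most \<open>n - 1 - c\<close>, hence different from \<open>n - 1\<close>:
  every cut costs at least one unit (\<open>nim_sum_cut_less\<close>).

  Conversely every \<open>v < n - 1\<close> is reached, because a pair of equal heaps cancels in the nim-sum and
  a heap of size 1 contributes \<open>0\<close>. Keep a heap of size \<open>v + 1\<close>. The deficit \<open>d = n - 1 - v\<close>
  is filled by a single heap of size 1 if \<open>d = 1\<close>, by two equal heaps if \<open>d\<close> is even, and by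
  two equal heaps together with a heap of size 1 if \<open>d \<ge> 3\<close> is odd (\<open>ex_cut_nim_sum_eq\<close>). These
  are cuts with \<open>c = 1\<close>, \<open>c = 2\<close> and \<open>c = 3\<close>, which is where the three required cut-numbers enter.
\<close>

lemma mex_eqI:
  assumes "k \<notin> U" and "\<And>v. v < k \<Longrightarrow> v \<in> U"
  shows "mex U = k"
  unfolding mex_def using assms by (intro Least_equality) (auto simp: not_less[symmetric])

lemma xor_le_add:
  fixes a b :: nat
  shows "xor a b \<le> a + b"
proof (induction a arbitrary: b rule: less_induct)
  case (less a)
  show ?case
  proof (cases "a = 0")
    case False
    then have "xor (a div 2) (b div 2) \<le> a div 2 + b div 2"
      by (intro less) simp
    \<comment> \<open>The lowest bits contribute \<open>\<bar>a mod 2 - b mod 2\<bar>\<close>, at most their sum.\<close>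
    moreover have "xor a b = of_bool (odd a \<noteq> odd b) + 2 * xor (a div 2) (b div 2)"
      by (rule xor_rec)
    moreover have "of_bool (odd a \<noteq> odd b) \<le> a mod 2 + b mod 2"
      by (auto simp: odd_iff_mod_2_eq_one)
    moreover have "a = 2 * (a div 2) + a mod 2" and "b = 2 * (b div 2) + b mod 2"
      by simp_all
    ultimately show ?thesis
      by linarith
  qed simp
qed

lemma nim_sum_le_sum_list: "nim_sum xs \<le> sum_list xs"
proof (induction xs)
  case (Cons x xs)
  then show ?case
    using xor_le_add[of x "nim_sum xs"] by (simp add: nim_sum_def)
qed (simp add: nim_sum_def)

lemma sum_list_map_pred:
  fixes ns :: "nat list"
  assumes "\<forall>m\<in>set ns. m \<ge> 1"
  shows "sum_list (map (\<lambda>m. m - 1) ns) + length ns = sum_list ns"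
  using assms by (induction ns) auto

text \<open>
  Each of the at least two heaps loses 1 in passing from its size to its nim-value, so the
  nim-values add up to at most \<open>n - 2\<close>, and the nim-sum does not exceed that sum.
\<close>

lemma nim_sum_cut_less:
  assumes "ns \<in> cuts C n"
  shows "nim_sum (map (\<lambda>m. m - 1) ns) < n - 1"
proof -
  have "sum_list (map (\<lambda>m. m - 1) ns) + length ns = n" and "length ns \<ge> 2"
    using assms sum_list_map_pred[of ns] by (auto simp: cuts_def)
  then show ?thesis
    using nim_sum_le_sum_list[of "map (\<lambda>m. m - 1) ns"] by linarith
qed

text \<open>
  Fixing \<open>c\<close> also fixes the sum \<open>n - 1 - c\<close> of the nim-values, whose parity is that of their
  nim-sum. Hence \<open>c\<close> must have the parity of the deficit \<open>n - 1 - v\<close>; the pair that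
  absorbs the rest requires \<open>c \<ge> 2\<close>.
\<close>

lemma ex_cut_nim_sum_eq:
  assumes C: "{1, 2, 3} \<subseteq> C" and v: "v < n - 1"
  shows "\<exists>ns\<in>cuts C n. nim_sum (map (\<lambda>m. m - 1) ns) = v"
proof -
  consider (one) "n = v + 2"
    | (even) a where "n = v + 2 * a + 3"
    | (odd) a where "n = v + 2 * a + 4"
  proof (cases "even (n - v)")
    case True
    then obtain k where "n - v = 2 * k" ..
    \<comment> \<open>The deficit \<open>2 * k - 1\<close> is 1 exactly if \<open>k = 1\<close>, when no room is left for a pair.\<close>
    then have "n = v + 2 \<or> n = v + 2 * (k - 2) + 4"
      using v by linarith
    then show ?thesis
      using one odd by blast
  next
    case False
    then obtain k where "n - v = 2 * k + 1" ..
    then have "n = v + 2 * (k - 1) + 3"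
      using v by linarith
    then show ?thesis
      using even by blast
  qed
  then show ?thesis
  proof cases
    case one
    then have "[v + 1, 1] \<in> cuts C n"
      using C by (force simp: cuts_def)
    then show ?thesis
      by (rule bexI[rotated]) (simp add: nim_sum_def)
  next
    case even
    then have "[v + 1, a + 1, a + 1] \<in> cuts C n"
      using C by (auto simp: cuts_def simp flip: numeral_2_eq_2)
    then show ?thesis
      by (rule bexI[rotated]) (simp add: nim_sum_def)
  next
    case odd
    then have "[v + 1, a + 1, a + 1, 1] \<in> cuts C n"
      using C by (auto simp: cuts_def simp flip: numeral_3_eq_3)
    then show ?thesis
      by (rule bexI[rotated]) (simp add: nim_sum_def)
  qed
qed

theorem proposition7:
  fixes C :: "nat set" and n :: nat
  assumes "ruleset C" and "{1, 2, 3} \<subseteq> C" and "n \<ge> 1"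
  shows "grundy C n = n - 1"
  using \<open>n \<ge> 1\<close>
proof (induction n rule: less_induct)
  case (less n)
  have "map (grundy C) ns = map (\<lambda>m. m - 1) ns" if "ns \<in> cuts C n" for ns
    using that less.IH cuts_less[OF that] by (auto simp: cuts_def)
  then have "grundy C n = mex ((\<lambda>ns. nim_sum (map (\<lambda>m. m - 1) ns)) ` cuts C n)"
    by (subst grundy.simps) (metis (no_types, lifting) image_cong)
  also have "\<dots> = n - 1"
  proof (rule mex_eqI)
    show "n - 1 \<notin> (\<lambda>ns. nim_sum (map (\<lambda>m. m - 1) ns)) ` cuts C n"
      using nim_sum_cut_less by fastforce
    show "v \<in> (\<lambda>ns. nim_sum (map (\<lambda>m. m - 1) ns)) ` cuts C n" if "v < n - 1" for v
      using ex_cut_nim_sum_eq[OF assms(2) that] by blast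
  qed
  finally show ?case .
qed

end
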